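(* Fix a constant integer $k\ge2$ and a constant $\varepsilon_0\in(0,\frac{1}{400\cdot 2^k})$. Any algorithm that, for every $n$-variable $(k,k,k-1)$-CNF formula $\Phi$, given i.i.d. uniform random solutions of $\Phi$, outputs a CNF formula $\widehat\Phi$ with $d_{\mathrm{TV}}(\mu_\Phi,\mu_{\widehat\Phi})\le\varepsilon_0$ with success probability $\frac13$, requires at least $\Omega_{k,\varepsilon_0}\big((\frac{n}{\log n})^{1-\frac2k}\big)$ samples.
   Context: A $(k,d,s)$-CNF formula is a CNF formula in which every clause contains exactly $k$ distinct variables, every variable appears in at most $d$ clauses, and any two distinct clauses share at most $s$ variables. $\mu_\Phi$ is the uniform distribution over satisfying assignments of $\Phi$, and $d_{\mathrm{TV}}$ is total variation distance. The output $\widehat\Phi$ may be an arbitrary CNF formula. *)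

theory Defs
  imports "HOL-Probability.Probability"
begin

text \<open>Variables are natural numbers; an n-variable formula uses variables in {0..<n}.
  A literal is a pair (variable, polarity): (v, True) is x_v, (v, False) is the negation.
  A clause is a finite set of literals, a CNF formula is a finite set of clauses.\<close>

type_synonym lit = "nat \<times> bool"
type_synonym clause = "lit set"
type_synonym cnf = "clause set"
type_synonym assignment = "nat \<Rightarrow> bool"

definition cvars :: "clause \<Rightarrow> nat set" where
  "cvars C = fst ` C"

definition fvars :: "cnf \<Rightarrow> nat set" where
  "fvars \<Phi> = (\<Union>C\<in>\<Phi>. cvars C)"

definition is_cnf :: "cnf \<Rightarrow> bool" where
  "is_cnf \<Phi> \<longleftrightarrow> finite \<Phi> \<and> (\<forall>C\<in>\<Phi>. finite C)"

text \<open>(k,d,s)-CNF: every clause has exactly k distinct variables (and k literals, so no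
  variable occurs twice in a clause), every variable occurs in at most d clauses,
  two distinct clauses share at most s variables.\<close>
definition kds_cnf :: "nat \<Rightarrow> nat \<Rightarrow> nat \<Rightarrow> cnf \<Rightarrow> bool" where
  "kds_cnf k d s \<Phi> \<longleftrightarrow> is_cnf \<Phi> \<and>
     (\<forall>C\<in>\<Phi>. card C = k \<and> card (cvars C) = k) \<and>
     (\<forall>v. card {C\<in>\<Phi>. v \<in> cvars C} \<le> d) \<and>
     (\<forall>C\<in>\<Phi>. \<forall>D\<in>\<Phi>. C \<noteq> D \<longrightarrow> card (cvars C \<inter> cvars D) \<le> s)"

definition sat_clause :: "assignment \<Rightarrow> clause \<Rightarrow> bool" where
  "sat_clause \<sigma> C \<longleftrightarrow> (\<exists>(v, b)\<in>C. \<sigma> v = b)"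

definition sat :: "assignment \<Rightarrow> cnf \<Rightarrow> bool" where
  "sat \<sigma> \<Phi> \<longleftrightarrow> (\<forall>C\<in>\<Phi>. sat_clause \<sigma> C)"

definition assignments :: "nat \<Rightarrow> assignment set" where
  "assignments n = {\<sigma>. \<forall>i\<ge>n. \<sigma> i = False}"

definition solutions :: "nat \<Rightarrow> cnf \<Rightarrow> assignment set" where
  "solutions n \<Phi> = {\<sigma> \<in> assignments n. sat \<sigma> \<Phi>}"

text \<open>Uniform distribution over satisfying assignments (meaningful when nonempty).\<close>
definition mu :: "nat \<Rightarrow> cnf \<Rightarrow> assignment pmf" where
  "mu n \<Phi> = pmf_of_set (solutions n \<Phi>)"

definition tv_dist :: "'a pmf \<Rightarrow> 'a pmf \<Rightarrow> real" where
  "tv_dist p q = (SUP A. \<bar>measure_pmf.prob p A - measure_pmf.prob q A\<bar>)"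

fun iid :: "nat \<Rightarrow> 'a pmf \<Rightarrow> 'a list pmf" where
  "iid 0 p = return_pmf []"
| "iid (Suc m) p = bind_pmf p (\<lambda>x. map_pmf (\<lambda>xs. x # xs) (iid m p))"

definition good_output :: "nat \<Rightarrow> real \<Rightarrow> cnf \<Rightarrow> cnf \<Rightarrow> bool" where
  "good_output n eps \<Phi> \<Phi>' \<longleftrightarrow> is_cnf \<Phi>' \<and> fvars \<Phi>' \<subseteq> {0..<n} \<and>
     solutions n \<Phi>' \<noteq> {} \<and> tv_dist (mu n \<Phi>) (mu n \<Phi>') \<le> eps"

definition learns :: "nat \<Rightarrow> nat \<Rightarrow> real \<Rightarrow> nat \<Rightarrow> (assignment list \<Rightarrow> cnf pmf) \<Rightarrow> bool" where
  "learns k n eps m A \<longleftrightarrow>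
     (\<forall>\<Phi>. kds_cnf k k (k - 1) \<Phi> \<and> fvars \<Phi> \<subseteq> {0..<n} \<and> solutions n \<Phi> \<noteq> {} \<longrightarrow>
        measure_pmf.prob (bind_pmf (iid m (mu n \<Phi>)) A) {\<Phi>'. good_output n eps \<Phi> \<Phi>'} \<ge> 1/3)"

end

theory Submission
  imports Defs "HOL-Real_Asymp.Real_Asymp"
begin

text \<open>
  The hard instances are disjoint unions of \<open>G\<close> gadgets. A gadget consists of \<open>L\<close> layers of
  \<open>k\<close> variables; for every layer and every \<open>a < k\<close> there is a clause saying that if the variables
  of that layer other than the \<open>a\<close>-th are all false, then the \<open>a\<close>-th variable of the next layer is
  false. Hence an all-false first layer forces the whole gadget to be false, so the optional
  additional clause that forbids an all-false first layer excludes exactly one of the \<open>Z\<close> solutions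
  of the gadget. As \<open>Z\<close> grows by a factor of at most \<open>2 ^ k\<close> per layer, and at least doubles
  when \<open>k \<ge> 3\<close>, some \<open>L = O(log G)\<close> gives \<open>G / 2 ^ k < Z \<le> G\<close>. Two formulas whose sets of
  constrained gadgets differ in a constant fraction of the gadgets are then far apart in total
  variation, but \<open>m\<close> samples reveal the unconstrained status of only about \<open>m G / Z\<close> gadgets.
  In the uniform distribution on pairs of a set \<open>S\<close> of constrained gadgets and a list of \<open>m\<close>
  solutions of the corresponding formula, given the list, \<open>S\<close> is uniform among the subsets of the
  gadgets not yet seen all-false, so a learner succeeds with small probability unless
  \<open>m \<ge> Z / 8\<close>.
\<close>

section \<open>Uniform samples and total variation distance\<close>

text \<open>The lists of length \<open>Suc m\<close> split by their head into disjoint classes of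
  equal size, so a uniform head followed by a uniform tail is a uniform list. This turns success
  probabilities into averages over lists.\<close>

lemma iid_pmf_of_set:
  assumes "finite X" "X \<noteq> {}"
  shows "iid m (pmf_of_set X) = pmf_of_set {xs. set xs \<subseteq> X \<and> length xs = m}"
proof (induction m)
  case 0
  have "{xs. set xs \<subseteq> X \<and> length xs = 0} = {[]}" by auto
  then show ?case by (simp add: pmf_of_set_singleton)
next
  case (Suc m)
  let ?L = "\<lambda>m. {xs. set xs \<subseteq> X \<and> length xs = m}"
  have fin: "finite (?L j)" for j using assms by (simp add: finite_lists_length_eq)
  have ne: "?L j \<noteq> {}" for j
    using card_lists_length_eq[OF assms(1), of j] assms by (metis card_eq_0_iff power_not_zero)
  have eq: "?L (Suc m) = (\<Union>x\<in>X. (#) x ` ?L m)"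
    by (auto simp: length_Suc_conv image_iff)
  have "pmf_of_set (?L (Suc m)) = pmf_of_set X \<bind> (\<lambda>x. pmf_of_set ((#) x ` ?L m))"
    unfolding eq
  proof (rule pmf_of_set_UN[where n = "card (?L m)"])
    show "finite (\<Union>x\<in>X. (#) x ` ?L m)" using fin assms by blast
    show "disjoint_family_on (\<lambda>x. (#) x ` ?L m) X" by (auto simp: disjoint_family_on_def)
    show "card ((#) x ` ?L m) = card (?L m)" for x by (rule card_image) simp
  qed (use assms ne in auto)
  also have "\<dots> = pmf_of_set X \<bind> (\<lambda>x. map_pmf ((#) x) (pmf_of_set (?L m)))"
    using ne fin by (subst map_pmf_of_set_inj) auto
  finally show ?case using Suc by simp
qed

lemma prob_bind_pmf_of_set:
  assumes "finite X" "X \<noteq> {}"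
  shows "measure_pmf.prob (bind_pmf (pmf_of_set X) A) E = (\<Sum>x\<in>X. measure_pmf.prob (A x) E) / card X"
proof -
  have "ennreal (measure_pmf.prob (bind_pmf (pmf_of_set X) A) E)
      = (\<Sum>x\<in>X. emeasure (measure_pmf (A x)) E) / card X"
    using assms by (simp add: nn_integral_pmf_of_set flip: measure_pmf.emeasure_eq_measure)
  also have "\<dots> = ennreal ((\<Sum>x\<in>X. measure_pmf.prob (A x) E) / card X)"
    using assms by (simp add: measure_pmf.emeasure_eq_measure sum_nonneg card_gt_0_iff
        flip: ennreal_of_nat_eq_real_of_nat) (simp add: divide_ennreal sum_nonneg card_gt_0_iff ennreal_of_nat_eq_real_of_nat)
  finally show ?thesis by (simp add: sum_nonneg)
qed

lemma prob_diff_le_tv_dist: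
  "\<bar>measure_pmf.prob p E - measure_pmf.prob q E\<bar> \<le> tv_dist p q"
  unfolding tv_dist_def
proof (rule cSUP_upper)
  show "bdd_above (range (\<lambda>E. \<bar>measure_pmf.prob p E - measure_pmf.prob q E\<bar>))"
  proof (rule bdd_aboveI2)
    fix E
    show "\<bar>measure_pmf.prob p E - measure_pmf.prob q E\<bar> \<le> 1"
      using measure_pmf.prob_le_1[of p E] measure_pmf.prob_le_1[of q E]
        measure_nonneg[of "measure_pmf p" E] measure_nonneg[of "measure_pmf q" E] by linarith
  qed
qed simp

section \<open>Counting, and set families of small diameter\<close>

lemma sum_if_eq_mult_card:
  fixes c :: real
  assumes "finite A"
  shows "(\<Sum>x\<in>A. if P x then c else 0) = c * card {x\<in>A. P x}"
  unfolding sum.inter_filter[OF assms, symmetric] by (simp only: sum_constant mult.commute)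

text \<open>The translates of the family by a chain of sets whose sizes are the multiples of
  \<^term>\<open>Suc D\<close> are pairwise disjoint.\<close>
lemma card_small_diameter_family:
  assumes U: "finite U" "\<B> \<subseteq> Pow U" and D: "\<And>S T. S \<in> \<B> \<Longrightarrow> T \<in> \<B> \<Longrightarrow> card (sym_diff S T) \<le> D"
    and q: "q * Suc D \<le> card U"
  shows "Suc q * card \<B> \<le> 2 ^ card U"
proof -
  obtain f where f: "bij_betw f {..<card U} U"
    using U(1) by (metis atLeast0LessThan ex_bij_betw_nat_finite)
  define V where "V i = f ` {..<i * Suc D}" for i
  have inj: "inj_on f {..<card U}" and ran: "f ` {..<card U} = U"
    using f by (auto simp: bij_betw_def)
  have mul: "i * Suc D \<le> card U" if "i \<le> q" for i
    using that q by (meson le_trans mult_le_mono1)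
  have VU: "V i \<subseteq> U" if "i \<le> q" for i
    using mul[OF that] ran unfolding V_def by (metis image_mono lessThan_subset_iff)
  have sep: "D < card (sym_diff (V i) (V j))" if "i < j" "j \<le> q" for i j
  proof -
    have "{i * Suc D..<j * Suc D} \<subseteq> {..<card U}" using mul[OF that(2)] by auto
    then have "card (f ` {i * Suc D..<j * Suc D}) = j * Suc D - i * Suc D"
      using inj by (simp add: card_image inj_on_subset)
    also have "\<dots> = (j - i) * Suc D" by (rule diff_mult_distrib[symmetric])
    also have "\<dots> > D" using that by (cases "j - i") auto
    finally have "D < card (f ` {i * Suc D..<j * Suc D})" .
    moreover have "f ` {i * Suc D..<j * Suc D} \<subseteq> sym_diff (V i) (V j)"
    proof -
      have "f ` ({..<j * Suc D} - {..<i * Suc D}) = V j - V i"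
        unfolding V_def using mul[of i] mul[of j] that inj
        by (intro inj_on_image_set_diff[of f "{..<card U}"]) auto
      moreover have "{i * Suc D..<j * Suc D} = {..<j * Suc D} - {..<i * Suc D}" by auto
      ultimately show ?thesis by auto
    qed
    moreover have "finite (sym_diff (V i) (V j))" by (simp add: V_def)
    ultimately show ?thesis by (rule less_le_trans[OF _ card_mono[rotated]])
  qed
  define g where "g = (\<lambda>(S, i). sym_diff S (V i))"
  have cancel: "sym_diff S T = sym_diff (V i) (V j)"
    if "sym_diff S (V i) = sym_diff T (V j)" for S T i j
    using that by blast
  \<comment> \<open>Equal translates force \<open>sym_diff S T = sym_diff (V i) (V j)\<close>, which
    has more than \<open>D\<close> elements unless \<open>i = j\<close>; after that
    \<open>S = T\<close> by cancellation.\<close>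
  have "inj_on g (\<B> \<times> {..q})"
  proof (rule inj_onI)
    fix a b assume ab: "a \<in> \<B> \<times> {..q}" "b \<in> \<B> \<times> {..q}" "g a = g b"
    obtain S i T j where [simp]: "a = (S, i)" "b = (T, j)" by (meson surj_pair)
    have *: "S \<in> \<B>" "T \<in> \<B>" "i \<in> {..q}" "j \<in> {..q}" "g (S, i) = g (T, j)"
      using ab by auto
    then have eq: "sym_diff S (V i) = sym_diff T (V j)" by (simp add: g_def)
    have le: "card (sym_diff S T) \<le> D" "card (sym_diff T S) \<le> D" using D * by auto
    have "i = j"
      using sep[of i j] sep[of j i] * le cancel[OF eq] cancel[OF eq[symmetric]]
      by (metis atMost_iff linorder_neqE_nat not_le)
    then show "a = b" using cancel[OF eq] by auto
  qed
  moreover have "g ` (\<B> \<times> {..q}) \<subseteq> Pow U" using U VU by (fastforce simp: g_def)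
  ultimately have "card (\<B> \<times> {..q}) \<le> card (Pow U)"
    using U by (meson card_inj_on_le finite_Pow_iff)
  then show ?thesis using U by (simp add: card_cartesian_product card_Pow mult.commute)
qed

section \<open>Independent defects on a finite space\<close>

text \<open>\<open>indep\<close> says, without division, that under the uniform distribution on
  \<open>\<Omega>\<close> an index is a defect with probability \<open>1 / Z\<close>, even
  conditionally on the absence of defects in any set of other indices. Later \<open>\<Omega>\<close>
  is the solution set with no gadget constrained, and a defect is an all-false gadget.\<close>

locale hidden_defects =
  fixes \<Omega> :: "'x set" and defects :: "'x \<Rightarrow> 'i set" and I :: "'i set" and Z :: nat
  assumes fin\<Omega>: "finite \<Omega>" "\<Omega> \<noteq> {}" and finI: "finite I" and Z2: "2 \<le> Z"
    and indep: "\<And>S i. S \<subseteq> I \<Longrightarrow> i \<in> I - S \<Longrightarrow>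
      Z * card {x\<in>\<Omega>. defects x \<inter> S = {} \<and> i \<in> defects x} = card {x\<in>\<Omega>. defects x \<inter> S = {}}"
begin

text \<open>In the application, the solutions of the formula whose constrained gadgets are
  \<open>S\<close>.\<close>

definition avoiding :: "'i set \<Rightarrow> 'x set" where
  "avoiding S = {x\<in>\<Omega>. defects x \<inter> S = {}}"

lemma finite_avoiding: "finite (avoiding S)"
  using fin\<Omega> by (simp add: avoiding_def)

lemma card_avoiding_insert:
  assumes "S \<subseteq> I" "i \<in> I - S"
  shows "real (card (avoiding (insert i S))) = (1 - 1 / Z) * card (avoiding S)"
proof -
  let ?B = "{x\<in>\<Omega>. defects x \<inter> S = {} \<and> i \<in> defects x}"
  have "avoiding (insert i S) = avoiding S - ?B" by (auto simp: avoiding_def)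
  moreover have sub: "?B \<subseteq> avoiding S" by (auto simp: avoiding_def)
  ultimately have "card (avoiding (insert i S)) = card (avoiding S) - card ?B"
    using fin\<Omega> by (simp add: card_Diff_subset)
  moreover have "card ?B \<le> card (avoiding S)" using sub finite_avoiding card_mono by blast
  moreover have "real Z * card ?B = card (avoiding S)"
    using indep[OF assms] by (simp add: avoiding_def flip: of_nat_mult)
  ultimately show ?thesis using Z2 by (simp add: field_simps of_nat_diff)
qed

lemma card_avoiding_Un:
  assumes "S \<subseteq> I" "R \<subseteq> I - S"
  shows "real (card (avoiding (S \<union> R))) = (1 - 1 / Z) ^ card R * card (avoiding S)"
proof -
  have "finite R" using assms finI finite_subset by blast
  then show ?thesis using assms(2)
  proof (induction R)
    case (insert i R)
    then have "real (card (avoiding (insert i (S \<union> R)))) = (1 - 1 / Z) * card (avoiding (S \<union> R))"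
      using assms(1) by (intro card_avoiding_insert) auto
    then show ?case using insert by simp
  qed simp
qed

lemma avoiding_nonempty: "S \<subseteq> I \<Longrightarrow> avoiding S \<noteq> {}"
proof
  assume "S \<subseteq> I" "avoiding S = {}"
  then have "(1 - 1 / Z) ^ card S * card (avoiding {}) = 0"
    using card_avoiding_Un[of "{}" S] by simp
  then show False using fin\<Omega> Z2 by (auto simp: avoiding_def)
qed

text \<open>The event \<open>avoiding S\<close> is the test: it has probability 1 under the first
  distribution and \<open>(1 - 1 / Z) ^ card (S - T)\<close> under the second, and both values lie
  within \<open>e\<close> of its probability under \<open>q\<close>.\<close>

lemma tv_dist_close_avoiding:
  assumes S: "S \<subseteq> I" "T \<subseteq> I"
    and tv: "tv_dist (pmf_of_set (avoiding S)) q \<le> e" "tv_dist (pmf_of_set (avoiding T)) q \<le> e"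
  shows "1 - 2 * e \<le> (1 - 1 / Z) ^ card (S - T)"
proof -
  have "measure_pmf.prob (pmf_of_set (avoiding S)) (avoiding S) = 1"
    using avoiding_nonempty[OF S(1)] finite_avoiding by (simp add: measure_pmf_of_set)
  moreover have "measure_pmf.prob (pmf_of_set (avoiding T)) (avoiding S) = (1 - 1 / Z) ^ card (S - T)"
  proof -
    have "avoiding T \<inter> avoiding S = avoiding (T \<union> (S - T))" by (auto simp: avoiding_def)
    then have "real (card (avoiding T \<inter> avoiding S)) = (1 - 1 / Z) ^ card (S - T) * card (avoiding T)"
      using card_avoiding_Un[of T "S - T"] S by auto
    then show ?thesis using avoiding_nonempty[OF S(2)] finite_avoiding
      by (simp add: measure_pmf_of_set)
  qed
  ultimately show ?thesis
    using prob_diff_le_tv_dist[of "pmf_of_set (avoiding S)" "avoiding S" q]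
      prob_diff_le_tv_dist[of "pmf_of_set (avoiding T)" "avoiding S" q] tv by linarith
qed

text \<open>With \<open>r = card (S - T)\<close>, closeness gives \<open>(1 - 1 / Z) ^ r\<close> at
  least 799/800. Its product with \<open>(1 + 1 / Z) ^ r\<close> is at most 1, and Bernoulli's
  inequality bounds the latter below by \<open>1 + r / Z\<close>; hence \<open>r / Z\<close> is at
  most 1/799.\<close>

lemma card_Diff_le_of_close:
  assumes "S \<subseteq> I" "T \<subseteq> I" "e \<le> 1 / 1600"
    and "tv_dist (pmf_of_set (avoiding S)) q \<le> e" "tv_dist (pmf_of_set (avoiding T)) q \<le> e"
  shows "799 * card (S - T) \<le> Z"
proof -
  let ?r = "card (S - T)" and ?d = "1 / real Z"
  have "799 / 800 \<le> (1 - ?d) ^ ?r" using tv_dist_close_avoiding[of S T q e] assms by simp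
  moreover have "1 + ?r * ?d \<le> (1 + ?d) ^ ?r"
    by (rule Bernoulli_inequality, rule order_trans[of _ 0]) auto
  moreover have "(1 - ?d) ^ ?r * (1 + ?d) ^ ?r \<le> 1"
  proof -
    have "(1 - ?d) ^ ?r * (1 + ?d) ^ ?r = (1 - ?d\<^sup>2) ^ ?r"
      by (simp add: power2_eq_square algebra_simps flip: power_mult_distrib)
    also have "\<dots> \<le> 1" using Z2 by (intro power_le_one) (auto simp: power_le_one)
    finally show ?thesis .
  qed
  ultimately have "799 / 800 * (1 + ?r * ?d) \<le> 1"
    using mult_mono[of "799 / 800" "(1 - ?d) ^ ?r" "1 + ?r * ?d" "(1 + ?d) ^ ?r"] by simp
  then have "799 * ?r \<le> real Z" using Z2 by (simp add: field_simps)
  then show ?thesis by linarith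
qed

section \<open>What the samples reveal\<close>

text \<open>For \<open>i\<close> outside \<open>S\<close>, the lists that never show defect
  \<open>i\<close> are those drawn from \<open>avoiding (insert i S)\<close>, a fraction
  \<open>(1 - 1 / Z) ^ m\<close> of all; Bernoulli's inequality bounds the rest.\<close>

lemma card_samples_with_defect:
  assumes "S \<subseteq> I" "i \<in> I"
  shows "real (card {xs. set xs \<subseteq> avoiding S \<and> length xs = m \<and> i \<in> \<Union> (defects ` set xs)})
    \<le> m / Z * card (avoiding S) ^ m"
proof (cases "i \<in> S")
  case True
  then have empty: "{xs. set xs \<subseteq> avoiding S \<and> length xs = m \<and> i \<in> \<Union> (defects ` set xs)} = {}"
    by (auto simp: avoiding_def)
  show ?thesis unfolding empty by simp
next
  case False
  let ?L = "\<lambda>X. {xs. set xs \<subseteq> X \<and> length xs = m}"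
  have "{xs. set xs \<subseteq> avoiding S \<and> length xs = m \<and> i \<in> \<Union> (defects ` set xs)}
     = ?L (avoiding S) - ?L (avoiding (insert i S))"
    by (fastforce simp: avoiding_def)
  moreover have "avoiding (insert i S) \<subseteq> avoiding S" by (auto simp: avoiding_def)
  then have "?L (avoiding (insert i S)) \<subseteq> ?L (avoiding S)" by auto
  ultimately have "real (card {xs. set xs \<subseteq> avoiding S \<and> length xs = m \<and> i \<in> \<Union> (defects ` set xs)})
     = real (card (?L (avoiding S))) - card (?L (avoiding (insert i S)))"
    by (simp add: card_Diff_subset finite_avoiding finite_lists_length_eq card_mono of_nat_diff del: Union_iff UN_iff)
  also have "\<dots> = (1 - (1 - 1 / Z) ^ m) * card (avoiding S) ^ m"
  proof -
    have "i \<in> I - S" using assms False by blast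
    note card_avoiding_insert[OF assms(1) this]
    then have "real (card (avoiding (insert i S)) ^ m) = (1 - 1 / Z) ^ m * real (card (avoiding S)) ^ m"
      by (simp only: of_nat_power power_mult_distrib)
    then show ?thesis
      by (simp only: card_lists_length_eq finite_avoiding left_diff_distrib mult_1 of_nat_power)
  qed
  also have "\<dots> \<le> m / Z * card (avoiding S) ^ m"
  proof (rule mult_right_mono)
    have "1 + m * (- (1 / real Z)) \<le> (1 + - (1 / real Z)) ^ m"
      using Z2 by (intro Bernoulli_inequality) simp
    then show "1 - (1 - 1 / real Z) ^ m \<le> m / Z" by simp
  qed simp
  finally show ?thesis .
qed

text \<open>Markov's inequality: averaged over the lists, at most \<open>m / Z * card I\<close>
  indices of \<open>I\<close> are seen as defects.\<close>

lemma card_samples_with_many_defects: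
  assumes "S \<subseteq> I" "I \<noteq> {}"
  shows "real (card {xs. set xs \<subseteq> avoiding S \<and> length xs = m \<and> card I < 2 * card (I \<inter> \<Union> (defects ` set xs))})
    \<le> 2 * m / Z * card (avoiding S) ^ m"
proof -
  let ?L = "{xs. set xs \<subseteq> avoiding S \<and> length xs = m}"
  let ?T = "\<lambda>xs. \<Union> (defects ` set xs)"
  let ?M = "{xs\<in>?L. card I < 2 * card (I \<inter> ?T xs)}"
  have fin: "finite ?L" by (simp add: finite_avoiding finite_lists_length_eq)
  have "real (card ?M) * card I = (\<Sum>xs\<in>?M. real (card I))" by simp
  also have "\<dots> \<le> (\<Sum>xs\<in>?M. 2 * real (card (I \<inter> ?T xs)))"
  proof (rule sum_mono)
    fix xs assume "xs \<in> ?M"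
    then have "card I < 2 * card (I \<inter> ?T xs)" by blast
    then show "real (card I) \<le> 2 * real (card (I \<inter> ?T xs))" by linarith
  qed
  also have "\<dots> \<le> (\<Sum>xs\<in>?L. 2 * real (card (I \<inter> ?T xs)))"
    by (rule sum_mono2) (use fin in auto)
  also have "\<dots> = (\<Sum>xs\<in>?L. \<Sum>i\<in>I. if i \<in> ?T xs then 2 else 0)"
    unfolding sum_if_eq_mult_card[OF finI] Int_def by (rule refl)
  also have "\<dots> = (\<Sum>i\<in>I. \<Sum>xs\<in>?L. if i \<in> ?T xs then 2 else 0)" by (rule sum.swap)
  also have "\<dots> = (\<Sum>i\<in>I. 2 * real (card {xs\<in>?L. i \<in> ?T xs}))"
    unfolding sum_if_eq_mult_card[OF fin] by (rule refl)
  also have "\<dots> \<le> (\<Sum>i\<in>I. 2 * (m / Z * card (avoiding S) ^ m))"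
  proof (intro sum_mono mult_left_mono)
    fix i assume "i \<in> I"
    from card_samples_with_defect[OF assms(1) this, of m]
    show "real (card {xs\<in>?L. i \<in> ?T xs}) \<le> m / Z * card (avoiding S) ^ m"
      by (simp only: mem_Collect_eq conj_assoc)
  qed simp
  also have "\<dots> = (2 * m / Z * card (avoiding S) ^ m) * card I" by simp
  finally have "real (card ?M) * card I \<le> (2 * m / Z * card (avoiding S) ^ m) * card I" .
  then have "real (card ?M) \<le> 2 * m / Z * card (avoiding S) ^ m"
    by (rule mult_right_le_imp_le) (use assms(2) finI in \<open>simp add: card_gt_0_iff\<close>)
  then show ?thesis by (simp only: mem_Collect_eq conj_assoc)
qed

text \<open>Double counting of the pairs of a set \<open>S\<close> and a list \<open>xs\<close> of
  \<open>m\<close> elements of \<open>avoiding S\<close>. Success has total weight at least 1/3 of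
  all pairs. Lists showing more than half of \<open>I\<close> contribute at most the fraction
  \<open>2 * m / Z\<close>, all other lists at most 1/16, and 1/3 - 1/16 exceeds 1/4.\<close>

lemma num_samples_ge:
  fixes A :: "'x list \<Rightarrow> 'o pmf" and good :: "'i set \<Rightarrow> 'o \<Rightarrow> bool"
  assumes "I \<noteq> {}"
    and close: "\<And>S T y. S \<subseteq> I \<Longrightarrow> T \<subseteq> I \<Longrightarrow> good S y \<Longrightarrow> good T y \<Longrightarrow> card (sym_diff S T) \<le> D"
    and D: "30 * Suc D \<le> card I"
    and succ: "\<And>S. S \<subseteq> I \<Longrightarrow>
      1 / 3 \<le> measure_pmf.prob (bind_pmf (iid m (pmf_of_set (avoiding S))) A) {y. good S y}"
  shows "real Z / 8 \<le> real m"
proof -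
  let ?L = "\<lambda>X. {xs. set xs \<subseteq> X \<and> length xs = m}"
  let ?T = "\<lambda>xs. \<Union> (defects ` set xs)"
  let ?many = "\<lambda>xs. card I < 2 * card (I \<inter> ?T xs)"
  let ?f = "\<lambda>S xs. measure_pmf.prob (A xs) {y. good S y}"
  define N :: real where "N = (\<Sum>S\<in>Pow I. real (card (avoiding S) ^ m))"
  have finL: "finite (?L (avoiding S))" "finite (?L \<Omega>)" for S
    using fin\<Omega> by (simp_all add: finite_avoiding finite_lists_length_eq)
  have cardL: "card (?L (avoiding S)) = card (avoiding S) ^ m" for S
    by (simp add: card_lists_length_eq finite_avoiding)
  have pos: "0 < card (avoiding S) ^ m" if "S \<subseteq> I" for S
    using avoiding_nonempty[OF that] finite_avoiding by (simp add: card_gt_0_iff)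
  have "N > 0" unfolding N_def using finI pos by (intro sum_pos) (auto simp del: of_nat_power)
  \<comment> \<open>A list is possible for \<open>S\<close> exactly if it shows no defect in
    \<open>S\<close>, so the sets compatible with \<open>xs\<close> are the subsets of
    \<open>I - ?T xs\<close>.\<close>
  have swap: "(\<Sum>S\<in>Pow I. \<Sum>xs\<in>?L (avoiding S). h S xs) = (\<Sum>xs\<in>?L \<Omega>. \<Sum>S\<in>Pow (I - ?T xs). h S xs)"
    for h :: "'i set \<Rightarrow> 'x list \<Rightarrow> real"
  proof -
    have 1: "?L (avoiding S) = {xs. xs \<in> ?L \<Omega> \<and> ?T xs \<inter> S = {}}" for S
      by (auto simp: avoiding_def)
    have 2: "Pow (I - ?T xs) = {S. S \<in> Pow I \<and> ?T xs \<inter> S = {}}" for xs by blast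
    show ?thesis unfolding 1 2 using finL(2) finI by (intro sum.swap_restrict) auto
  qed
  have N_eq: "N = (\<Sum>xs\<in>?L \<Omega>. 2 ^ card (I - ?T xs))"
  proof -
    have "N = (\<Sum>S\<in>Pow I. \<Sum>xs\<in>?L (avoiding S). 1)" by (simp add: N_def cardL)
    also have "\<dots> = (\<Sum>xs\<in>?L \<Omega>. \<Sum>S\<in>Pow (I - ?T xs). 1)" by (rule swap)
    finally show ?thesis using finI by (simp add: card_Pow)
  qed
  have few: "(\<Sum>S\<in>Pow (I - ?T xs). ?f S xs) \<le> 2 ^ card (I - ?T xs) / 16" if "\<not> ?many xs" for xs
  proof -
    let ?U = "I - ?T xs"
    have "card I = card ?U + card (I \<inter> ?T xs)" using finI by (metis card_Int_Diff add.commute)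
    then have U: "15 * Suc D \<le> card ?U" using that D by simp
    have finU: "finite (Pow ?U)" using finI by simp
    have int: "integrable (A xs) (indicat_real E)" for E
      by (rule measure_pmf.integrable_const_bound[where B = 1]) auto
    \<comment> \<open>Exchanging sum and expectation fixes the output \<open>y\<close>. The sets for
      which this \<open>y\<close> is good form a family of diameter at most \<open>D\<close>, hence
      at most 1/16 of the subsets of \<open>?U\<close>, because
      \<open>15 * Suc D \<le> card ?U\<close>.\<close>
    have "(\<Sum>S\<in>Pow ?U. ?f S xs)
        = (\<Sum>S\<in>Pow ?U. measure_pmf.expectation (A xs) (indicator {y. good S y}))" by simp
    also have "\<dots> = measure_pmf.expectation (A xs) (\<lambda>y. \<Sum>S\<in>Pow ?U. indicator {y. good S y} y)"
      by (rule Bochner_Integration.integral_sum[symmetric]) (rule int)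
    also have "\<dots> \<le> measure_pmf.expectation (A xs) (\<lambda>y. 2 ^ card ?U / 16)"
    proof (rule integral_mono)
      show "integrable (A xs) (\<lambda>y. \<Sum>S\<in>Pow ?U. indicator {y. good S y} y :: real)"
        using int by (rule Bochner_Integration.integrable_sum)
      fix y
      let ?B = "{S\<in>Pow ?U. good S y}"
      have "Suc 15 * card ?B \<le> 2 ^ card ?U"
      proof (rule card_small_diameter_family)
        show "card (sym_diff S T) \<le> D" if "S \<in> ?B" "T \<in> ?B" for S T
          using that by (intro close[of _ _ y]) auto
      qed (use finI U in auto)
      then have "real (Suc 15 * card ?B) \<le> real (2 ^ card ?U)" using of_nat_le_iff by blast
      moreover have "(\<Sum>S\<in>Pow ?U. indicator {y. good S y} y :: real) = card ?B"
        using sum_if_eq_mult_card[OF finU, of "\<lambda>S. good S y" 1] by (simp add: indicator_def of_bool_def)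
      ultimately show "(\<Sum>S\<in>Pow ?U. indicator {y. good S y} y :: real) \<le> 2 ^ card ?U / 16" by simp
    qed simp
    finally show ?thesis by simp
  qed
  have "N / 3 = (\<Sum>S\<in>Pow I. 1 / 3 * real (card (avoiding S) ^ m))"
    by (simp add: N_def flip: sum_distrib_left sum_divide_distrib)
  also have "\<dots> \<le> (\<Sum>S\<in>Pow I. \<Sum>xs\<in>?L (avoiding S). ?f S xs)"
  proof (rule sum_mono)
    fix S assume "S \<in> Pow I"
    then have S: "S \<subseteq> I" by simp
    have ne: "?L (avoiding S) \<noteq> {}" using pos[OF S] cardL[of S] by (metis card.empty less_irrefl)
    have "iid m (pmf_of_set (avoiding S)) = pmf_of_set (?L (avoiding S))"
      using finite_avoiding avoiding_nonempty[OF S] by (rule iid_pmf_of_set)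
    then have "1 / 3 \<le> (\<Sum>xs\<in>?L (avoiding S). ?f S xs) / card (?L (avoiding S))"
      using succ[OF S] prob_bind_pmf_of_set[OF finL(1) ne, of A "{y. good S y}"] by simp
    then show "1 / 3 * real (card (avoiding S) ^ m) \<le> (\<Sum>xs\<in>?L (avoiding S). ?f S xs)"
      unfolding cardL using pos[OF S] by (simp add: pos_le_divide_eq del: of_nat_power)
  qed
  \<comment> \<open>On lists that show many defects, the success probability is replaced by
    1.\<close>
  also have "\<dots> \<le> (\<Sum>S\<in>Pow I. \<Sum>xs\<in>?L (avoiding S). (if ?many xs then 1 else 0) + (if ?many xs then 0 else ?f S xs))"
    by (intro sum_mono) auto
  also have "\<dots> = (\<Sum>S\<in>Pow I. \<Sum>xs\<in>?L (avoiding S). if ?many xs then 1 else 0)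
      + (\<Sum>S\<in>Pow I. \<Sum>xs\<in>?L (avoiding S). if ?many xs then 0 else ?f S xs)"
    by (simp add: sum.distrib)
  also have "\<dots> \<le> 2 * m / Z * N + N / 16"
  proof (rule add_mono)
    have "(\<Sum>S\<in>Pow I. \<Sum>xs\<in>?L (avoiding S). if ?many xs then 1 else 0 :: real)
        = (\<Sum>S\<in>Pow I. real (card {xs. set xs \<subseteq> avoiding S \<and> length xs = m \<and> ?many xs}))"
      unfolding sum_if_eq_mult_card[OF finL(1)] by (simp only: mem_Collect_eq conj_assoc mult_1)
    also have "\<dots> \<le> (\<Sum>S\<in>Pow I. 2 * m / Z * card (avoiding S) ^ m)"
    proof (rule sum_mono)
      fix S assume "S \<in> Pow I"
      then have "S \<subseteq> I" by simp
      from card_samples_with_many_defects[OF this assms(1), of m]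
      show "real (card {xs. set xs \<subseteq> avoiding S \<and> length xs = m \<and> ?many xs})
          \<le> 2 * m / Z * card (avoiding S) ^ m" by simp
    qed
    finally show "(\<Sum>S\<in>Pow I. \<Sum>xs\<in>?L (avoiding S). if ?many xs then 1 else 0 :: real) \<le> 2 * m / Z * N"
      by (simp add: N_def sum_distrib_left)
    have "(\<Sum>S\<in>Pow I. \<Sum>xs\<in>?L (avoiding S). if ?many xs then 0 else ?f S xs)
       = (\<Sum>xs\<in>?L \<Omega>. if ?many xs then 0 else \<Sum>S\<in>Pow (I - ?T xs). ?f S xs)"
      unfolding swap by (intro sum.cong) auto
    also have "\<dots> \<le> (\<Sum>xs\<in>?L \<Omega>. 2 ^ card (I - ?T xs) / 16)"
      using few by (intro sum_mono) auto
    finally show "(\<Sum>S\<in>Pow I. \<Sum>xs\<in>?L (avoiding S). if ?many xs then 0 else ?f S xs) \<le> N / 16"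
      by (simp add: N_eq sum_divide_distrib)
  qed
  finally have "N / 3 \<le> (2 * m / Z + 1 / 16) * N" by (simp add: algebra_simps)
  then have "1 / 3 \<le> 2 * m / Z + 1 / 16" using \<open>N > 0\<close> by simp
  then show ?thesis using Z2 by (simp add: field_simps)
qed

end

section \<open>The chain formulas\<close>

text \<open>Layer \<open>p\<close> consists of the variables \<open>p * k + j\<close> with
  \<open>j < k\<close>. Layers are numbered through all gadgets: gadget \<open>i\<close> owns layers
  \<open>i * L\<close> to \<open>i * L + L - 1\<close>.\<close>

definition layer_clause :: "nat \<Rightarrow> nat \<Rightarrow> nat \<Rightarrow> clause" where
  "layer_clause k p a = (\<lambda>j. (p * k + j, True)) ` ({..<k} - {a}) \<union> {(Suc p * k + a, False)}"

definition start_clause :: "nat \<Rightarrow> nat \<Rightarrow> clause" where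
  "start_clause k p = (\<lambda>j. (p * k + j, True)) ` {..<k}"

text \<open>The condition \<open>Suc p mod L \<noteq> 0\<close> leaves out the step from the last
  layer of a gadget to the next gadget, so no clause connects two gadgets.\<close>

definition chain_cnf :: "nat \<Rightarrow> nat \<Rightarrow> nat \<Rightarrow> nat set \<Rightarrow> cnf" where
  "chain_cnf k L G S =
     (\<lambda>(p, a). layer_clause k p a) ` ({p. p < G * L \<and> Suc p mod L \<noteq> 0} \<times> {..<k})
     \<union> (\<lambda>i. start_clause k (i * L)) ` S"

text \<open>The solutions of a single unconstrained gadget, moved to the variables below
  \<open>L * k\<close>.\<close>

definition gadgets :: "nat \<Rightarrow> nat \<Rightarrow> assignment set" where
  "gadgets k L = {g \<in> assignments (L * k). \<forall>t a. Suc t < L \<longrightarrow> a < k \<longrightarrow>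
     g (Suc t * k + a) \<longrightarrow> (\<exists>j\<in>{..<k} - {a}. g (t * k + j))}"

text \<open>The part of \<open>\<sigma>\<close> on gadget \<open>i\<close>, shifted to the origin
  and cut off at \<open>K\<close> so that it lies in \<open>assignments K\<close>.\<close>

definition block :: "nat \<Rightarrow> nat \<Rightarrow> assignment \<Rightarrow> assignment" where
  "block K i \<sigma> = (\<lambda>v. v < K \<and> \<sigma> (i * K + v))"

definition patch :: "nat \<Rightarrow> nat \<Rightarrow> assignment \<Rightarrow> assignment \<Rightarrow> assignment" where
  "patch K i g \<sigma> = (\<lambda>v. if i * K \<le> v \<and> v < Suc i * K then g (v - i * K) else \<sigma> v)"

lemma finite_assignments: "finite (assignments n)"
proof -
  have "assignments n \<subseteq> (\<lambda>A v. v \<in> A) ` Pow {..<n}"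
  proof
    fix \<sigma> assume "\<sigma> \<in> assignments n"
    then have "{v. \<sigma> v} \<in> Pow {..<n}" by (auto simp: assignments_def not_le[symmetric])
    moreover have "\<sigma> = (\<lambda>v. v \<in> {v. \<sigma> v})" by simp
    ultimately show "\<sigma> \<in> (\<lambda>A v. v \<in> A) ` Pow {..<n}" by blast
  qed
  then show ?thesis by (rule finite_subset) simp
qed

section \<open>Clause sizes, degrees and intersections\<close>

lemma cvars_layer_clause: "cvars (layer_clause k p a) = (\<lambda>j. p * k + j) ` ({..<k} - {a}) \<union> {Suc p * k + a}"
  unfolding cvars_def layer_clause_def image_Un image_image by simp

lemma cvars_start_clause: "cvars (start_clause k p) = (\<lambda>j. p * k + j) ` {..<k}"
  unfolding cvars_def start_clause_def image_image by simp

lemma card_layer_clause: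
  assumes "a < k"
  shows "card (layer_clause k p a) = k" "card (cvars (layer_clause k p a)) = k"
proof -
  have "(Suc p * k + a, False) \<notin> (\<lambda>j. (p * k + j, True)) ` ({..<k} - {a})" by auto
  moreover have "Suc p * k + a \<notin> (\<lambda>j. p * k + j) ` ({..<k} - {a})" by auto
  moreover have "card ((\<lambda>j. (p * k + j, True)) ` ({..<k} - {a})) = k - 1"
    using assms by (subst card_image) (auto simp: inj_on_def)
  moreover have "card ((\<lambda>j. p * k + j) ` ({..<k} - {a})) = k - 1"
    using assms by (subst card_image) (auto simp: inj_on_def)
  ultimately show "card (layer_clause k p a) = k" "card (cvars (layer_clause k p a)) = k"
    unfolding cvars_layer_clause unfolding layer_clause_def using assms by simp_all
qed

lemma card_start_clause: "card (start_clause k p) = k" "card (cvars (start_clause k p)) = k"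
  unfolding cvars_start_clause unfolding start_clause_def
  by (subst card_image; simp add: inj_on_def)+

text \<open>Division by \<open>k\<close> reads off the layers that a clause meets. As
  \<open>2 \<le> k\<close>, layer \<open>p\<close> keeps a variable once the \<open>a\<close>-th is
  removed.\<close>

lemma div_cvars_layer_clause:
  assumes "a < k" "2 \<le> k"
  shows "(\<lambda>v. v div k) ` cvars (layer_clause k p a) = {p, Suc p}"
proof -
  have "{..<k} - {a} \<noteq> {}" using assms card_Diff_singleton[of a "{..<k}"] by force
  moreover have "(p * k + j) div k = p" if "j < k" for j using that by simp
  moreover have "(Suc p * k + a) div k = Suc p" using assms by (subst div_mult_self3) auto
  ultimately show ?thesis unfolding cvars_layer_clause image_Un image_image
    by (auto simp: image_iff simp del: mult_Suc)
qed

lemma div_cvars_start_clause: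
  assumes "2 \<le> k"
  shows "(\<lambda>v. v div k) ` cvars (start_clause k p) = {p}"
proof -
  have "0 < k" using assms by simp
  then show ?thesis unfolding cvars_start_clause image_image by (auto simp: image_iff)
qed

text \<open>The layers met determine \<open>p\<close>, and the only variable in layer
  \<open>Suc p\<close> determines \<open>a\<close>.\<close>

lemma cvars_layer_clause_inj:
  assumes "a < k" "b < k" "2 \<le> k" and eq: "cvars (layer_clause k p a) = cvars (layer_clause k q b)"
  shows "p = q \<and> a = b"
proof -
  have "{p, Suc p} = {q, Suc q}"
    using div_cvars_layer_clause[of a k p] div_cvars_layer_clause[of b k q] assms by simp
  then have "p = q" by (auto simp: doubleton_eq_iff)
  have "Suc p * k + a \<in> cvars (layer_clause k q b)" using eq by (auto simp: cvars_layer_clause)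
  moreover have "Suc p * k + a \<noteq> q * k + j" if "j < k" for j using that \<open>p = q\<close> by simp
  ultimately show ?thesis using \<open>p = q\<close> by (auto simp: cvars_layer_clause)
qed

text \<open>Layer clauses meet two layers and start clauses one, so the variables reveal the kind of
  clause. As all clauses have exactly \<open>k\<close> variables, injectivity is what bounds
  intersections by \<open>k - 1\<close>.\<close>

lemma cvars_inj_chain_cnf:
  assumes "2 \<le> k"
  shows "inj_on cvars (chain_cnf k L G S)"
proof (rule inj_onI)
  fix C D assume C: "C \<in> chain_cnf k L G S" and D: "D \<in> chain_cnf k L G S" and eq: "cvars C = cvars D"
  have form: "(\<exists>p a. a < k \<and> X = layer_clause k p a) \<or> (\<exists>p. X = start_clause k p)"
    if "X \<in> chain_cnf k L G S" for X using that by (auto simp: chain_cnf_def)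
  have eq': "(\<lambda>v. v div k) ` cvars C = (\<lambda>v. v div k) ` cvars D" using eq by simp
  note divs = div_cvars_layer_clause[OF _ assms] div_cvars_start_clause[OF assms]
  from form[OF C] form[OF D] show "C = D"
  proof (elim disjE exE conjE)
    fix p a q b assume *: "a < k" "C = layer_clause k p a" "b < k" "D = layer_clause k q b"
    then show ?thesis using cvars_layer_clause_inj[OF *(1,3) assms, of p q] eq by simp
  next
    fix p a q assume *: "a < k" "C = layer_clause k p a" "D = start_clause k q"
    have "{p, Suc p} = {q}" using eq'[unfolded *(2,3) divs(1)[OF *(1)] divs(2)] .
    then show ?thesis by auto
  next
    fix p q b assume *: "C = start_clause k p" "b < k" "D = layer_clause k q b"
    have "{p} = {q, Suc q}" using eq'[unfolded *(1,3) divs(1)[OF *(2)] divs(2)] .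
    then show ?thesis by auto
  next
    fix p q assume *: "C = start_clause k p" "D = start_clause k q"
    have "{p} = {q}" using eq'[unfolded * divs(2)] .
    then show ?thesis using * by simp
  qed
qed

text \<open>Variable \<open>j\<close> of layer \<open>p\<close> occurs in at most
  \<open>k - 1\<close> clauses leading from layer \<open>p\<close> to the next, those with
  \<open>a \<noteq> j\<close>, and in at most one further clause.\<close>

lemma card_clauses_of_var_chain_cnf:
  assumes "2 \<le> k" "0 < L"
  shows "card {C \<in> chain_cnf k L G S. v \<in> cvars C} \<le> k"
proof -
  define p j where "p = v div k" and "j = v mod k"
  have j: "j < k" using assms by (simp add: j_def)
  have eqD: "p = q \<and> j = b" if "v = q * k + b" "b < k" for q b
    using that by (simp add: p_def j_def)
  \<comment> \<open>No layer clause leads into the first layer of a gadget, so there the start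
    clause takes the free place and the degree stays within \<open>k\<close>.\<close>
  define C0 where "C0 = (if p mod L = 0 then start_clause k p else layer_clause k (p - 1) j)"
  have "{C \<in> chain_cnf k L G S. v \<in> cvars C} \<subseteq> layer_clause k p ` ({..<k} - {j}) \<union> {C0}"
  proof
    fix C assume "C \<in> {C \<in> chain_cnf k L G S. v \<in> cvars C}"
    then have C: "C \<in> chain_cnf k L G S" "v \<in> cvars C" by auto
    from C(1) consider q a where "C = layer_clause k q a" "a < k" "Suc q mod L \<noteq> 0"
      | i where "C = start_clause k (i * L)" by (auto simp: chain_cnf_def)
    then show "C \<in> layer_clause k p ` ({..<k} - {j}) \<union> {C0}"
    proof cases
      case 1
      from C(2) consider b where "v = q * k + b" "b < k" "b \<noteq> a" | "v = Suc q * k + a"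
        unfolding 1 cvars_layer_clause by auto
      then show ?thesis
      proof cases
        case 1 then show ?thesis using eqD[of q b] \<open>a < k\<close> \<open>C = _\<close> by auto
      next
        case 2 then have "p = Suc q" "j = a" using eqD[OF 2 \<open>a < k\<close>] by auto
        then show ?thesis using \<open>Suc q mod L \<noteq> 0\<close> \<open>C = _\<close> by (simp add: C0_def)
      qed
    next
      case 2
      then obtain b where "v = (i * L) * k + b" "b < k" using C(2) by (auto simp: cvars_start_clause)
      then have "p = i * L" using eqD by blast
      then show ?thesis using 2 by (simp add: C0_def)
    qed
  qed
  then have "card {C \<in> chain_cnf k L G S. v \<in> cvars C} \<le> card (layer_clause k p ` ({..<k} - {j}) \<union> {C0})"
    by (intro card_mono) auto
  also have "\<dots> \<le> card ({..<k} - {j}) + 1"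
    by (rule order_trans[OF card_Un_le add_mono[OF card_image_le]]) auto
  also have "\<dots> = k" using j by simp
  finally show ?thesis .
qed

lemma kds_cnf_chain_cnf:
  assumes "2 \<le> k" "0 < L" "finite S"
  shows "kds_cnf k k (k - 1) (chain_cnf k L G S)"
proof -
  have fin: "finite (chain_cnf k L G S)"
    using assms finite_subset[of "{p. p < G * L \<and> Suc p mod L \<noteq> 0}" "{..<G * L}"]
    by (auto simp: chain_cnf_def intro!: finite_imageI)
  have card: "card C = k \<and> card (cvars C) = k" if "C \<in> chain_cnf k L G S" for C
    using that card_layer_clause card_start_clause by (auto simp: chain_cnf_def)
  have "card (cvars C \<inter> cvars D) \<le> k - 1"
    if "C \<in> chain_cnf k L G S" "D \<in> chain_cnf k L G S" "C \<noteq> D" for C D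
  proof (rule ccontr)
    assume "\<not> card (cvars C \<inter> cvars D) \<le> k - 1"
    then have ge: "card (cvars C \<inter> cvars D) \<ge> k" by simp
    have f: "finite (cvars C)" "finite (cvars D)" using card that assms(1) by (auto intro: card_ge_0_finite)
    have "cvars C \<inter> cvars D = cvars C"
      using f ge card[OF that(1)] by (intro card_seteq) auto
    moreover have "cvars C \<inter> cvars D = cvars D"
      using f ge card[OF that(2)] by (intro card_seteq) auto
    ultimately have "cvars C = cvars D" by simp
    then have "C = D" by (rule inj_onD[OF cvars_inj_chain_cnf[OF assms(1)] _ that(1,2)])
    then show False using that by simp
  qed
  moreover have "finite C" if "C \<in> chain_cnf k L G S" for C
    using card[OF that] assms(1) by (auto intro: card_ge_0_finite)
  ultimately show ?thesis
    using fin card card_clauses_of_var_chain_cnf[OF assms(1,2)] by (simp add: kds_cnf_def is_cnf_def)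
qed

lemma fvars_chain_cnf:
  assumes "0 < L" "S \<subseteq> {..<G}" "G * (L * k) \<le> n"
  shows "fvars (chain_cnf k L G S) \<subseteq> {0..<n}"
proof -
  have lt: "p * k + j < n" if "p < G * L" "j < k" for p j
  proof -
    have "p * k + j < Suc p * k" using that by simp
    also have "\<dots> \<le> G * L * k" using that by (intro mult_le_mono1) simp
    finally show ?thesis using assms(3) by (simp add: mult.assoc)
  qed
  \<comment> \<open>\<open>Suc p = G * L\<close> would be a multiple of \<open>L\<close>.\<close>
  have next_lt: "Suc p < G * L" if "p < G * L" "Suc p mod L \<noteq> 0" for p
    using that by (metis Suc_lessI mod_mult_self2_is_0)
  have start_lt: "i * L < G * L" if "i \<in> S" for i using that assms by auto
  have "cvars C \<subseteq> {0..<n}" if "C \<in> chain_cnf k L G S" for C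
  proof -
    from that consider p a where "C = layer_clause k p a" "a < k" "p < G * L" "Suc p mod L \<noteq> 0"
      | i where "C = start_clause k (i * L)" "i \<in> S" by (auto simp: chain_cnf_def)
    then show ?thesis
    proof cases
      case 1
      show ?thesis using lt[OF \<open>p < G * L\<close>] lt[OF next_lt[OF 1(3,4)] 1(2)]
        unfolding 1 cvars_layer_clause by (auto simp del: mult_Suc)
    next
      case 2
      show ?thesis using lt[OF start_lt[OF 2(2)]] unfolding 2 cvars_start_clause by auto
    qed
  qed
  then show ?thesis by (auto simp: fvars_def)
qed

section \<open>Solutions, gadget by gadget\<close>

text \<open>Writing a layer number as \<open>p = i * L + t\<close> with \<open>t < L\<close> sorts
  the clauses by gadget.\<close>

lemma sat_chain_cnf_iff:
  assumes "0 < L" "S \<subseteq> {..<G}"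
  shows "sat \<sigma> (chain_cnf k L G S) \<longleftrightarrow>
    (\<forall>i<G. block (L * k) i \<sigma> \<in> gadgets k L) \<and> (\<forall>i\<in>S. \<exists>j<k. block (L * k) i \<sigma> j)"
proof -
  let ?Q = "\<lambda>p a. \<sigma> (Suc p * k + a) \<longrightarrow> (\<exists>j\<in>{..<k} - {a}. \<sigma> (p * k + j))"
  have lt: "t * k + a < L * k" if "t < L" "a < k" for t a
  proof -
    have "t * k + a < Suc t * k" using that by simp
    also have "\<dots> \<le> L * k" using that by (intro mult_le_mono1) simp
    finally show ?thesis .
  qed
  have sat_layer: "sat_clause \<sigma> (layer_clause k p a) \<longleftrightarrow> ?Q p a" for p a
    unfolding sat_clause_def layer_clause_def bex_Un by auto
  have sat_start: "sat_clause \<sigma> (start_clause k p) \<longleftrightarrow> (\<exists>j<k. \<sigma> (p * k + j))" for p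
    unfolding sat_clause_def start_clause_def by auto
  have block_eq: "block (L * k) i \<sigma> (t * k + a) = \<sigma> ((i * L + t) * k + a)" if "t < L" "a < k" for i t a
    using lt[OF that] by (simp add: block_def algebra_simps)
  have gadget: "block (L * k) i \<sigma> \<in> gadgets k L \<longleftrightarrow> (\<forall>t a. Suc t < L \<longrightarrow> a < k \<longrightarrow> ?Q (i * L + t) a)" for i
  proof -
    have "block (L * k) i \<sigma> \<in> assignments (L * k)" by (simp add: assignments_def block_def)
    moreover have "(block (L * k) i \<sigma> (Suc t * k + a) \<longrightarrow> (\<exists>j\<in>{..<k} - {a}. block (L * k) i \<sigma> (t * k + j)))
        = ?Q (i * L + t) a" if "Suc t < L" "a < k" for t a
      using block_eq[OF that, of i] block_eq[of t _ i] that(1) by auto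
    ultimately show ?thesis unfolding gadgets_def by blast
  qed
  have "(\<forall>p a. p < G * L \<longrightarrow> Suc p mod L \<noteq> 0 \<longrightarrow> a < k \<longrightarrow> ?Q p a) \<longleftrightarrow>
     (\<forall>i<G. \<forall>t a. Suc t < L \<longrightarrow> a < k \<longrightarrow> ?Q (i * L + t) a)"
  proof (intro iffI allI impI)
    fix i t a assume *: "\<forall>p a. p < G * L \<longrightarrow> Suc p mod L \<noteq> 0 \<longrightarrow> a < k \<longrightarrow> ?Q p a"
      and **: "i < G" "Suc t < L" "a < k" "\<sigma> (Suc (i * L + t) * k + a)"
    have "i * L + t < Suc i * L" using ** by simp
    also have "\<dots> \<le> G * L" using ** by (intro mult_le_mono1) simp
    finally have "i * L + t < G * L" .
    moreover have "Suc (i * L + t) mod L \<noteq> 0"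
      using **(2) by (metis add_Suc_right mod_less mod_mult_self3 nat.distinct(1))
    ultimately show "\<exists>j\<in>{..<k} - {a}. \<sigma> ((i * L + t) * k + j)" using * ** by blast
  next
    fix p a assume *: "\<forall>i<G. \<forall>t a. Suc t < L \<longrightarrow> a < k \<longrightarrow> ?Q (i * L + t) a"
      and **: "p < G * L" "Suc p mod L \<noteq> 0" "a < k" "\<sigma> (Suc p * k + a)"
    have "p div L < G" using ** assms by (simp add: less_mult_imp_div_less)
    moreover have "Suc (p mod L) < L" using **(2) assms(1) by (metis Suc_lessI mod_Suc mod_less_divisor)
    moreover have "p div L * L + p mod L = p" by simp
    ultimately show "\<exists>j\<in>{..<k} - {a}. \<sigma> (p * k + j)" using * ** by metis
  qed
  moreover have "(\<exists>j<k. block (L * k) i \<sigma> j) \<longleftrightarrow> (\<exists>j<k. \<sigma> (i * L * k + j))" for i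
    using block_eq[OF assms(1), of _ i] by auto
  moreover have "sat \<sigma> (chain_cnf k L G S) \<longleftrightarrow>
      (\<forall>p a. p < G * L \<longrightarrow> Suc p mod L \<noteq> 0 \<longrightarrow> a < k \<longrightarrow> sat_clause \<sigma> (layer_clause k p a))
      \<and> (\<forall>i\<in>S. sat_clause \<sigma> (start_clause k (i * L)))"
    unfolding sat_def chain_cnf_def ball_Un by auto
  ultimately show ?thesis unfolding sat_layer sat_start gadget by simp
qed

text \<open>Falsity spreads: below an all-false layer every layer clause can hold only through its
  negative literal, so the next layer is all false too.\<close>

lemma gadget_eq_zero:
  assumes "g \<in> gadgets k L" "0 < L" and start: "\<And>j. j < k \<Longrightarrow> \<not> g j"
  shows "g = (\<lambda>_. False)"
proof -
  have layer: "\<forall>j<k. \<not> g (t * k + j)" if "t < L" for t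
    using that
  proof (induction t)
    case (Suc t)
    then show ?case using assms(1) unfolding gadgets_def by auto
  qed (use start in auto)
  have "\<not> g v" for v
  proof (cases "v < L * k")
    case True
    then have "0 < k" by (cases k) auto
    have "v div k < L" using True by (rule less_mult_imp_div_less)
    with \<open>0 < k\<close> show ?thesis using layer[of "v div k"] by (metis div_mult_mod_eq mod_less_divisor)
  qed (use assms(1) in \<open>simp add: gadgets_def assignments_def\<close>)
  then show ?thesis by auto
qed

section \<open>Independence of the gadgets\<close>

lemma zero_in_gadgets: "(\<lambda>_. False) \<in> gadgets k L"
  by (simp add: gadgets_def assignments_def)

lemma block_patch_same: "g \<in> assignments K \<Longrightarrow> block K i (patch K i g \<sigma>) = g"
  by (auto simp: block_def patch_def assignments_def not_le[symmetric])

lemma block_patch_other: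
  assumes "i \<noteq> i'"
  shows "block K i' (patch K i g \<sigma>) = block K i' \<sigma>"
proof -
  have "\<not> (i * K \<le> i' * K + v \<and> i' * K + v < Suc i * K)" if "v < K" for v
  proof (cases "i < i'")
    case True
    then have "Suc i * K \<le> i' * K" by (intro mult_le_mono1) simp
    then show ?thesis by linarith
  next
    case False
    then have "Suc i' * K \<le> i * K" using assms by (intro mult_le_mono1) simp
    then show ?thesis using that by simp
  qed
  then show ?thesis by (auto simp: block_def patch_def)
qed

lemma patch_block: "patch K i (block K i \<sigma>) \<sigma> = \<sigma>"
  by (auto simp: block_def patch_def)

lemma patch_patch: "patch K i g (patch K i h \<sigma>) = patch K i g \<sigma>"
  by (auto simp: patch_def)

lemma patch_in_assignments:
  assumes "\<sigma> \<in> assignments n" "Suc i * K \<le> n"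
  shows "patch K i g \<sigma> \<in> assignments n"
  using assms by (auto simp: assignments_def patch_def)


text \<open>Overwriting gadget \<open>i\<close> matches the pairs of an assignment that is all false
  on gadget \<open>i\<close> and an arbitrary gadget solution with the assignments free on gadget
  \<open>i\<close>. As \<open>i\<close> is not in \<open>S\<close>, this leaves the defects in
  \<open>S\<close> unchanged.\<close>

lemma hidden_defects_chain:
  assumes "2 \<le> k" "0 < L" and n: "G * (L * k) \<le> n"
  shows "hidden_defects {\<sigma> \<in> assignments n. \<forall>i<G. block (L * k) i \<sigma> \<in> gadgets k L}
    (\<lambda>\<sigma>. {i. i < G \<and> block (L * k) i \<sigma> = (\<lambda>_. False)}) {..<G} (card (gadgets k L))"
    (is "hidden_defects ?\<Omega> ?d _ _")
proof
  let ?K = "L * k" and ?z = "(\<lambda>_. False) :: assignment"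
  show "finite ?\<Omega>" "finite {..<G}" using finite_assignments by simp_all
  have "?z \<in> ?\<Omega>" using zero_in_gadgets[of k L] by (simp add: assignments_def block_def)
  then show "?\<Omega> \<noteq> {}" by blast
  have fin: "finite (gadgets k L)" using finite_assignments by (simp add: gadgets_def)
  have "0 < L * k" using assms by simp
  \<comment> \<open>If only variable 0 is true, all later layers are false and every implication
    holds vacuously.\<close>
  then have "{?z, \<lambda>v. v = 0} \<subseteq> gadgets k L"
    using zero_in_gadgets by (auto simp: gadgets_def assignments_def intro!: gr0I)
  moreover have "card {?z, \<lambda>v. v = 0} = 2" by (auto simp: fun_eq_iff card_insert_if)
  ultimately show "2 \<le> card (gadgets k L)" using fin card_mono by metis
  fix S i assume "S \<subseteq> {..<G}" "i \<in> {..<G} - S"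
  then have i: "i < G" "i \<notin> S" by auto
  have "Suc i * ?K \<le> G * ?K" using i by (intro mult_le_mono1) simp
  then have in_n: "patch ?K i g \<sigma> \<in> assignments n" if "\<sigma> \<in> assignments n" for g \<sigma>
    using that n by (intro patch_in_assignments) auto
  let ?X = "{\<sigma>\<in>?\<Omega>. ?d \<sigma> \<inter> S = {} \<and> i \<in> ?d \<sigma>}" and ?Y = "{\<sigma>\<in>?\<Omega>. ?d \<sigma> \<inter> S = {}}"
  have same: "block ?K i (patch ?K i g \<sigma>) = g" if "g \<in> gadgets k L" for g \<sigma>
    using that by (intro block_patch_same) (simp add: gadgets_def)
  have bl: "block ?K j (patch ?K i g \<sigma>) = (if j = i then g else block ?K j \<sigma>)" if "g \<in> gadgets k L" for j g \<sigma>
    using same[OF that] block_patch_other[of i j] by simp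
  have "bij_betw (\<lambda>(\<sigma>, g). patch ?K i g \<sigma>) (?X \<times> gadgets k L) ?Y"
  proof (rule bij_betw_byWitness[where f' = "\<lambda>\<sigma>. (patch ?K i ?z \<sigma>, block ?K i \<sigma>)"])
    have "patch ?K i ?z \<sigma> = \<sigma>" if "\<sigma> \<in> ?X" for \<sigma>
      using that patch_block[of ?K i \<sigma>] by simp
    then show "\<forall>a\<in>?X \<times> gadgets k L. (case case a of (\<sigma>, g) \<Rightarrow> patch ?K i g \<sigma> of
        \<sigma> \<Rightarrow> (patch ?K i ?z \<sigma>, block ?K i \<sigma>)) = a"
      by (auto simp: patch_patch same)
    show "\<forall>\<sigma>\<in>?Y. (case (patch ?K i ?z \<sigma>, block ?K i \<sigma>) of (\<sigma>, g) \<Rightarrow> patch ?K i g \<sigma>) = \<sigma>"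
      by (simp add: patch_patch patch_block)
    show "(\<lambda>(\<sigma>, g). patch ?K i g \<sigma>) ` (?X \<times> gadgets k L) \<subseteq> ?Y"
      using i by (auto simp: in_n bl split: if_splits)
    show "(\<lambda>\<sigma>. (patch ?K i ?z \<sigma>, block ?K i \<sigma>)) ` ?Y \<subseteq> ?X \<times> gadgets k L"
      using i zero_in_gadgets[of k L] by (auto simp: in_n bl split: if_splits)
  qed
  then have "card (?X \<times> gadgets k L) = card ?Y" by (rule bij_betw_same_card)
  then show "card (gadgets k L) * card ?X = card ?Y" by (simp only: card_cartesian_product mult.commute)
qed

section \<open>The number of solutions of a gadget\<close>

lemma card_gadgets_0: "card (gadgets k 0) = 1"
proof -
  have "gadgets k 0 = {\<lambda>_. False}" by (auto simp: gadgets_def assignments_def)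
  then show ?thesis by simp
qed

text \<open>A solution with \<open>Suc L\<close> layers is determined by its first \<open>L\<close>
  layers, again a gadget solution, and the set of true variables in its last layer.\<close>

lemma card_gadgets_Suc: "card (gadgets k (Suc L)) \<le> 2 ^ k * card (gadgets k L)"
proof -
  let ?f = "\<lambda>g. (block (L * k) 0 g, {a\<in>{..<k}. g (L * k + a)})"
  have "inj_on ?f (gadgets k (Suc L))"
  proof (rule inj_onI)
    fix g h assume g: "g \<in> gadgets k (Suc L)" and h: "h \<in> gadgets k (Suc L)" and eq: "?f g = ?f h"
    have "g v = h v" for v
    proof -
      consider "v < L * k" | a where "v = L * k + a" "a < k" | "Suc L * k \<le> v"
        by (metis add.commute le_add_diff_inverse less_diff_conv2 mult_Suc not_le)
      then show ?thesis
      proof cases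
        case 1
        have "block (L * k) 0 g v = block (L * k) 0 h v" using eq by simp
        then show ?thesis using 1 by (simp add: block_def)
      next
        case 2
        have "a \<in> {a\<in>{..<k}. g (L * k + a)} \<longleftrightarrow> a \<in> {a\<in>{..<k}. h (L * k + a)}" using eq by simp
        then show ?thesis using 2 by simp
      next
        case 3
        then show ?thesis using g h unfolding gadgets_def assignments_def by blast
      qed
    qed
    then show "g = h" by auto
  qed
  moreover have "?f ` gadgets k (Suc L) \<subseteq> gadgets k L \<times> Pow {..<k}"
  proof -
    have "block (L * k) 0 g \<in> gadgets k L" if g: "g \<in> gadgets k (Suc L)" for g
    proof -
      have "block (L * k) 0 g (t * k + a) = g (t * k + a)" if "t < L" "a < k" for t a
      proof -
        have "t * k + a < Suc t * k" using that by simp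
        also have "\<dots> \<le> L * k" using that by (intro mult_le_mono1) simp
        finally show ?thesis by (simp add: block_def)
      qed
      note eq = this
      show ?thesis unfolding gadgets_def
      proof (intro CollectI conjI allI impI)
        show "block (L * k) 0 g \<in> assignments (L * k)" by (simp add: assignments_def block_def)
        fix t a assume *: "Suc t < L" "a < k" "block (L * k) 0 g (Suc t * k + a)"
        then have "\<exists>j\<in>{..<k} - {a}. g (t * k + j)"
          using g eq[OF *(1,2)] unfolding gadgets_def by auto
        then show "\<exists>j\<in>{..<k} - {a}. block (L * k) 0 g (t * k + j)"
          using eq[of t] *(1) by auto
      qed
    qed
    then show ?thesis by auto
  qed
  moreover have "finite (gadgets k L \<times> Pow {..<k})"
    using finite_assignments by (simp add: gadgets_def)
  ultimately have "card (gadgets k (Suc L)) \<le> card (gadgets k L \<times> Pow {..<k})"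
    by (rule card_inj_on_le)
  then show ?thesis by (simp add: card_cartesian_product card_Pow mult.commute)
qed

text \<open>If the first two variables of every layer are true, every clause of the chain holds, so the
  third variables are free.\<close>
lemma card_gadgets_ge:
  assumes "3 \<le> k"
  shows "2 ^ L \<le> card (gadgets k L)"
proof -
  let ?f = "\<lambda>B v. v < L * k \<and> (v mod k < 2 \<or> v mod k = 2 \<and> v div k \<in> B)"
  have lt: "t * k + a < L * k" if "t < L" "a < k" for t a
  proof -
    have "t * k + a < Suc t * k" using that by simp
    also have "\<dots> \<le> L * k" using that by (intro mult_le_mono1) simp
    finally show ?thesis .
  qed
  have "inj_on ?f (Pow {..<L})"
  proof (rule inj_onI)
    fix A B assume *: "A \<in> Pow {..<L}" "B \<in> Pow {..<L}" "?f A = ?f B"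
    have "t \<in> A \<longleftrightarrow> t \<in> B" if "t < L" for t
    proof -
      have "(t * k + 2) mod k = 2" unfolding mod_mult_self3 using assms by simp
      moreover have "(t * k + 2) div k = t"
        using assms by (subst div_mult_self3) auto
      moreover have "t * k + 2 < L * k" using lt[OF that, of 2] assms by simp
      ultimately show ?thesis using fun_cong[OF *(3), of "t * k + 2"] by (simp only:) simp
    qed
    then show "A = B" using * by auto
  qed
  moreover have "?f ` Pow {..<L} \<subseteq> gadgets k L"
  proof (clarify)
    fix B assume "B \<subseteq> {..<L}"
    have "\<exists>j\<in>{..<k} - {a}. ?f B (t * k + j)" if "Suc t < L" for t a
    proof
      let ?j = "if a = 0 then 1 else 0 :: nat"
      show "?j \<in> {..<k} - {a}" using assms by auto
      show "?f B (t * k + ?j)" using lt[of t ?j] that assms by simp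
    qed
    then show "?f B \<in> gadgets k L" by (auto simp: gadgets_def assignments_def)
  qed
  moreover have "finite (gadgets k L)" using finite_assignments by (simp add: gadgets_def)
  ultimately have "card (Pow {..<L}) \<le> card (gadgets k L)" by (rule card_inj_on_le)
  then show ?thesis by (simp add: card_Pow)
qed

section \<open>The sample bound\<close>

lemma learns_num_samples_ge:
  assumes k: "2 \<le> k" and L: "0 < L" and n: "G * (L * k) \<le> n" and e: "e \<le> 1 / 1600"
    and G: "100 \<le> G" "card (gadgets k L) \<le> G" and A: "learns k n e m A"
  shows "real (card (gadgets k L)) / 8 \<le> real m"
proof -
  interpret hidden_defects "{\<sigma> \<in> assignments n. \<forall>i<G. block (L * k) i \<sigma> \<in> gadgets k L}"
    "\<lambda>\<sigma>. {i. i < G \<and> block (L * k) i \<sigma> = (\<lambda>_. False)}" "{..<G}" "card (gadgets k L)"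
    using k L n by (rule hidden_defects_chain)
  have sol: "solutions n (chain_cnf k L G S) = avoiding S" if S: "S \<subseteq> {..<G}" for S
  proof -
    \<comment> \<open>By propagation, a start clause holds exactly if its gadget is not all
      false.\<close>
    have nonzero: "(\<exists>j<k. g j) \<longleftrightarrow> g \<noteq> (\<lambda>_. False)" if "g \<in> gadgets k L" for g
      using gadget_eq_zero[OF that L] by auto
    have "sat \<sigma> (chain_cnf k L G S) \<longleftrightarrow> (\<forall>i<G. block (L * k) i \<sigma> \<in> gadgets k L)
        \<and> (\<forall>i\<in>S. block (L * k) i \<sigma> \<noteq> (\<lambda>_. False))" for \<sigma>
      unfolding sat_chain_cnf_iff[OF L S] using S nonzero by blast
    then show ?thesis using S unfolding solutions_def avoiding_def by blast
  qed
  show ?thesis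
  \<comment> \<open>Two sets with a common good output satisfy
    \<open>799 * card (S - T) \<le> card (gadgets k L) \<le> G\<close>, and likewise for
    \<open>T - S\<close>, which gives this \<open>D\<close>. The bound \<open>100 \<le> G\<close>
    absorbs the additive term in \<open>30 * Suc D \<le> G\<close>.\<close>
  proof (rule num_samples_ge[where good = "\<lambda>S. good_output n e (chain_cnf k L G S)" and D = "2 * (G div 799)"])
    show "{..<G} \<noteq> {}" using G by (auto simp: lessThan_empty_iff)
    have "799 * (G div 799) \<le> G" by simp
    then show "30 * Suc (2 * (G div 799)) \<le> card {..<G}" using G(1) by simp
    fix S assume S: "S \<subseteq> {..<G}"
    show "1 / 3 \<le> measure_pmf.prob (iid m (pmf_of_set (avoiding S)) \<bind> A)
        {y. good_output n e (chain_cnf k L G S) y}"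
      using A S kds_cnf_chain_cnf[OF k L, of S G] fvars_chain_cnf[OF L S n] avoiding_nonempty[OF S]
        finite_subset[OF S]
      unfolding learns_def mu_def sol[OF S, symmetric] by simp
    fix T y assume T: "T \<subseteq> {..<G}"
      and good: "good_output n e (chain_cnf k L G S) y" "good_output n e (chain_cnf k L G T) y"
    have tv: "tv_dist (pmf_of_set (avoiding S)) (mu n y) \<le> e" "tv_dist (pmf_of_set (avoiding T)) (mu n y) \<le> e"
      using good sol[OF S] sol[OF T] by (simp_all add: good_output_def mu_def)
    have "card (S - T) \<le> G div 799" "card (T - S) \<le> G div 799"
      using card_Diff_le_of_close[OF S T e tv] card_Diff_le_of_close[OF T S e tv(2,1)] G(2) by linarith+
    then show "card (sym_diff S T) \<le> 2 * (G div 799)"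
      using card_Un_le[of "S - T" "T - S"] by linarith
  qed
qed

text \<open>\<open>L\<close> precedes the first length with more than \<open>G\<close> solutions,
  which exists because the counts grow at least like \<open>2 ^ l\<close>. One layer multiplies the
  count by at most \<open>2 ^ k\<close>, hence the lower bound; \<open>2 ^ k \<le> G\<close>
  excludes \<open>L = 0\<close>, where the count is 1.\<close>

lemma ex_chain_length:
  assumes k: "3 \<le> k" and G: "2 ^ k \<le> G"
  obtains L where "0 < L" "card (gadgets k L) \<le> G" "G < 2 ^ k * card (gadgets k L)"
proof -
  define l where "l = (LEAST l. G < card (gadgets k l))"
  have "G < card (gadgets k G)" using card_gadgets_ge[OF k, of G] less_exp[of G] by linarith
  then have l: "G < card (gadgets k l)" unfolding l_def by (rule LeastI)
  have "(1::nat) \<le> 2 ^ k" by simp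
  then have "1 \<le> G" using G by linarith
  then obtain L where L: "l = Suc L" using l card_gadgets_0[of k] by (cases l) auto
  have "card (gadgets k L) \<le> G"
    using not_less_Least[of L "\<lambda>l. G < card (gadgets k l)"] L by (simp add: l_def)
  moreover have "G < 2 ^ k * card (gadgets k L)"
    using l card_gadgets_Suc[of k L] L by simp
  moreover have "L \<noteq> 0"
  proof
    assume "L = 0"
    then show False using calculation(2) G card_gadgets_0[of k] by simp
  qed
  ultimately show ?thesis using that by blast
qed

theorem theorem1p9:
  fixes k :: nat and eps0 :: real
  assumes "k \<ge> 2" and "0 < eps0" and "eps0 < 1 / (400 * 2 ^ k)"
  shows "\<exists>c>0. \<exists>N. \<forall>n\<ge>N. \<forall>m A. learns k n eps0 m A \<longrightarrow>
           real m \<ge> c * (real n / ln (real n)) powr (1 - 2 / real k)"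
proof -
  have "(2::real) ^ 2 \<le> 2 ^ k" using assms(1) by (intro power_increasing) auto
  then have "1 / (400 * 2 ^ k) \<le> (1 / 1600 :: real)" by (intro divide_left_mono) auto
  then have e: "eps0 \<le> 1 / 1600" using assms(3) by linarith
  show ?thesis
  proof (cases "k = 2")
    \<comment> \<open>The exponent is 0, so a positive constant bound suffices; 100 gadgets with one
      layer of two variables each provide it.\<close>
    case True
    have le4: "card (gadgets 2 1) \<le> 4"
      using card_gadgets_Suc[of 2 0] card_gadgets_0[of 2] by simp
    have "1 / 4 \<le> real m" if "learns k n eps0 m A" "200 \<le> n" for n m A
    proof -
      have n: "100 * (1 * 2) \<le> n" using that by simp
      have "2 \<le> card (gadgets 2 1)"
        using hidden_defects.Z2[OF hidden_defects_chain[OF _ _ n]] by simp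
      moreover have "real (card (gadgets 2 1)) / 8 \<le> real m"
        using that True le4 e by (intro learns_num_samples_ge[OF _ _ n]) auto
      ultimately show ?thesis by linarith
    qed
    moreover have "x powr (1 - 2 / real k) \<le> 1" for x :: real using True by simp
    ultimately have "1 / 4 * (real n / ln (real n)) powr (1 - 2 / real k) \<le> real m"
      if "learns k n eps0 m A" "200 \<le> n" for n m A
      using that by (metis mult_left_le order_trans zero_le_divide_1_iff zero_le_numeral)
    then show ?thesis by (intro exI[of _ "1 / 4"] conjI exI[of _ 200]) auto
  next
    case False
    then have k: "3 \<le> k" using assms(1) by simp
    \<comment> \<open>Chosen so that the gadgets fit into \<open>n\<close> variables:
      \<open>2 ^ L \<le> G \<le> n\<close> yields \<open>L * k * b \<le> ln n\<close>, so
      \<open>G \<le> b * n / ln n\<close> implies \<open>G * (L * k) \<le> n\<close>.\<close>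
    define b where "b = ln 2 / real k"
    have b: "0 < b" "b \<le> 1" using k ln_2_less_1 by (auto simp: b_def field_simps)
    \<comment> \<open>From \<open>C\<close> on, \<open>G\<close> is at least 100 and
      \<open>2 ^ k\<close>; the extra 1 pays for rounding down.\<close>
    define C where "C = (1 + max 100 (2 ^ k)) / b"
    have "filterlim (\<lambda>n. real n / ln (real n)) at_top sequentially" by real_asymp
    then have "eventually (\<lambda>n. max 1 C \<le> real n / ln (real n)) sequentially"
      by (simp only: filterlim_at_top)
    then obtain N where N: "max 1 C \<le> real n / ln (real n)" if "N \<le> n" for n
      by (auto simp: eventually_sequentially)
    have "b / (16 * 2 ^ k) * (real n / ln (real n)) powr (1 - 2 / real k) \<le> real m"
      if A: "learns k n eps0 m A" and n: "max 3 N \<le> n" for n m A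
    proof -
      define x where "x = real n / ln (real n)"
      have "max 1 C \<le> x" unfolding x_def by (rule N) (use n in simp)
      then have x: "1 \<le> x" "C \<le> x" by simp_all
      define G where "G = nat \<lfloor>b * x\<rfloor>"
      have "1 + max 100 (2 ^ k) \<le> b * x" using x(2) b by (simp add: C_def field_simps)
      moreover have floor: "real G \<le> b * x" "b * x < real G + 1"
        using b x by (auto simp: G_def)
      ultimately have "max 100 (2 ^ k) \<le> real G" by linarith
      then have G: "100 \<le> real G" "2 ^ k \<le> real G" by auto
      then have G': "100 \<le> G" "2 ^ k \<le> G" by (auto simp flip: of_nat_le_iff)
      from k G'(2) obtain L where L: "0 < L" "card (gadgets k L) \<le> G" "G < 2 ^ k * card (gadgets k L)"
        by (rule ex_chain_length)
      \<comment> \<open>This is where \<open>3 \<le> n\<close> enters, through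
        \<open>exp 1 \<le> 3\<close>.\<close>
      have ln: "1 \<le> ln (real n)" using n exp_le by (subst ln_ge_iff) auto
      have "x \<le> real n" using ln unfolding x_def by (simp add: field_simps mult_le_cancel_left1)
      then have "real G \<le> real n" using floor(1) b x mult_right_mono[of b 1 x] by linarith
      have "2 ^ L \<le> G" using card_gadgets_ge[OF k, of L] L(2) by linarith
      then have "(2::real) ^ L \<le> real n" using \<open>real G \<le> real n\<close>
        by (metis of_nat_le_iff of_nat_numeral of_nat_power order_trans)
      then have "ln ((2::real) ^ L) \<le> ln (real n)" using n by (subst ln_le_cancel_iff) auto
      then have "real L * ln 2 \<le> ln (real n)" by (simp add: ln_realpow)
      then have "real L * k * b \<le> ln (real n)" using k by (simp add: b_def)
      then have "(real L * k * b) * x \<le> ln (real n) * x" using x by (intro mult_right_mono) auto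
      also have "\<dots> = real n" using ln by (simp add: x_def)
      finally have "real L * k * (b * x) \<le> real n" by (simp add: mult.assoc)
      then have "real L * k * real G \<le> real n"
        using mult_left_mono[OF floor(1), of "real L * k"] by simp
      then have "real (G * (L * k)) \<le> real n" by (simp add: mult_ac)
      then have "G * (L * k) \<le> n" by (simp only: of_nat_le_iff)
      then have "real (card (gadgets k L)) / 8 \<le> real m"
        by (rule learns_num_samples_ge[OF assms(1) L(1) _ e G'(1) L(2) A])
      then have "2 ^ k * real (card (gadgets k L)) \<le> 2 ^ k * (8 * real m)"
        by (intro mult_left_mono) auto
      moreover have "real G \<le> 2 ^ k * card (gadgets k L)"
        using L(3) by (metis less_imp_le of_nat_le_iff of_nat_mult of_nat_numeral of_nat_power)
      \<comment> \<open>Rounding costs at most a factor 2; with the factors 8 and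
        \<open>2 ^ k\<close> this makes up the denominator of the constant.\<close>
      moreover have "b * x \<le> 2 * real G" using floor G by linarith
      ultimately have "b * x \<le> 16 * 2 ^ k * real m"
        unfolding of_nat_mult of_nat_power of_nat_numeral by linarith
      then have "b / (16 * 2 ^ k) * x \<le> real m" by (simp add: field_simps)
      \<comment> \<open>The bound obtained is linear in \<open>x\<close>; since
        \<open>1 \<le> x\<close>, it implies the one with the smaller exponent.\<close>
      moreover have "x powr (1 - 2 / real k) \<le> x powr 1" using x k by (intro powr_mono) auto
      then have "b / (16 * 2 ^ k) * x powr (1 - 2 / real k) \<le> b / (16 * 2 ^ k) * x"
        using x b by (intro mult_left_mono) auto
      ultimately show ?thesis by (simp add: x_def)
    qed
    then show ?thesis using b by (intro exI[of _ "b / (16 * 2 ^ k)"] conjI exI[of _ "max 3 N"]) auto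
  qed
qed

end
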